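(* Let $n \ge 4$ be an even integer and let $T_{2n}(W)$ be the Toeplitz graph with vertex set $\{x_1,\dots,x_{2n}\}$ in which $x_i$ and $x_j$ are adjacent if and only if $|i-j|$ is odd or $|i-j| = n$. Let $k$ be an integer with $1 < k \le \frac{n}{2}-1$. Then the $k$-domination number satisfies $\gamma_k(T_{2n}(W)) = 2k$.
   Context: $T_{2n}(W)$ is defined from $W = \{x_1, x_3, \dots, x_{2n-1}\} \cup \{x_n\}$: distinct vertices $x_i, x_j$ ($1\le i,j\le 2n$) are adjacent iff $|i-j| = t$ for some $x_t \in W$, i.e. iff $|i-j|$ is odd or equals $n$. For a graph $G$ and an integer $k\ge 1$, a subset $D \subseteq V(G)$ is a $k$-dominating set if every vertex of $V(G)\setminus D$ has at least $k$ neighbors in $D$. The $k$-domination number $\gamma_k(G)$ is the minimum cardinality of a $k$-dominating set of $G$. *)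

theory Defs
  imports "Graph_Theory.Pair_Digraph"
begin

text \<open>
  Graphs follow the convention of the Graph Theory library: a finite simple undirected graph is a
  symmetric, loop-free digraph (locale \<open>pair_graph\<close>), with every edge present as both of its arcs.
  The vertex \<open>x\<^sub>i\<close> of a Toeplitz graph is represented by its index \<open>i\<close>.
\<close>

definition toeplitz_graph :: "nat \<Rightarrow> nat set \<Rightarrow> nat pair_pre_digraph" where
  "toeplitz_graph m T =
     \<lparr> pverts = {1..m},
       parcs = {(i, j). i \<in> {1..m} \<and> j \<in> {1..m} \<and> i \<noteq> j \<and> nat \<bar>int i - int j\<bar> \<in> T} \<rparr>"

text \<open>The index set of \<open>W = {x\<^sub>1, x\<^sub>3, \<dots>, x\<^bsub>2n-1\<^esub>} \<union> {x\<^sub>n}\<close>.\<close>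

definition toeplitz_W :: "nat \<Rightarrow> nat set" where
  "toeplitz_W n = {2 * i - 1 | i. 1 \<le> i \<and> i \<le> n} \<union> {n}"

definition neighbors :: "'a pair_pre_digraph \<Rightarrow> 'a \<Rightarrow> 'a set" where
  "neighbors G v = {u \<in> pverts G. (v, u) \<in> parcs G}"

definition k_dominating_set :: "'a pair_pre_digraph \<Rightarrow> nat \<Rightarrow> 'a set \<Rightarrow> bool" where
  "k_dominating_set G k D \<longleftrightarrow>
     D \<subseteq> pverts G \<and> (\<forall>v \<in> pverts G - D. k \<le> card (neighbors G v \<inter> D))"

text \<open>
  Meaningful for finite graphs; there the minimum is over a nonempty finite set, since the full
  vertex set is \<open>k\<close>-dominating.
\<close>

definition k_domination_number :: "'a pair_pre_digraph \<Rightarrow> nat \<Rightarrow> nat" where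
  "k_domination_number G k = Min {card D | D. k_dominating_set G k D}"

lemma pair_graph_toeplitz_graph: "pair_graph (toeplitz_graph m T)"
proof
  have "parcs (toeplitz_graph m T) \<subseteq> {1..m} \<times> {1..m}"
    by (auto simp: toeplitz_graph_def)
  then show "finite (parcs (toeplitz_graph m T))"
    by (rule finite_subset) simp
  show "symmetric (toeplitz_graph m T)"
    by (auto simp: symmetric_def sym_def toeplitz_graph_def abs_minus_commute)
qed (auto simp: toeplitz_graph_def)

lemma toeplitz_graph_W_adjacent_iff:
  assumes "i \<in> {1..2 * n}" and "j \<in> {1..2 * n}" and "i \<noteq> j"
  shows "(i, j) \<in> parcs (toeplitz_graph (2 * n) (toeplitz_W n)) \<longleftrightarrow>
           odd \<bar>int i - int j\<bar> \<or> \<bar>int i - int j\<bar> = int n"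
proof -
  define d where "d = nat \<bar>int i - int j\<bar>"
  have d: "\<bar>int i - int j\<bar> = int d" "d < 2 * n"
    using assms by (auto simp: d_def)
  have "(\<exists>l. d = 2 * l - 1 \<and> 1 \<le> l \<and> l \<le> n) \<longleftrightarrow> odd d"
  proof
    assume "odd d"
    then obtain q where "d = 2 * q + 1" by (rule oddE)
    then show "\<exists>l. d = 2 * l - 1 \<and> 1 \<le> l \<and> l \<le> n"
      using d(2) by (intro exI[of _ "q + 1"]) auto
  qed auto
  then have "d \<in> toeplitz_W n \<longleftrightarrow> odd d \<or> d = n"
    by (auto simp: toeplitz_W_def)
  with assms d show ?thesis
    by (simp add: toeplitz_graph_def)
qed

lemma k_dominating_set_pverts: "k_dominating_set G k (pverts G)"
  by (simp add: k_dominating_set_def)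

lemma finite_card_k_dominating_sets:
  assumes "finite (pverts G)"
  shows "finite {card D | D. k_dominating_set G k D}"
proof -
  have "{card D | D. k_dominating_set G k D} \<subseteq> card ` Pow (pverts G)"
    by (auto simp: k_dominating_set_def)
  with assms show ?thesis by (meson finite_Pow_iff finite_imageI finite_subset)
qed

end

theory Submission
  imports Defs
begin

text \<open>
  For even \<open>n\<close> the graph is a complete bipartite graph between the odd and the even indices, plus a
  perfect matching \<open>i \<leftrightarrow> i + n\<close> inside each part. Any \<open>k\<close> vertices from each part form a
  \<open>k\<close>-dominating set. Conversely, if a \<open>k\<close>-dominating set has fewer than \<open>k\<close> vertices in one part,
  then a vertex missing from the other part gets at most \<open>k - 1\<close> chosen neighbours from the first
  one, so exactly \<open>k - 1\<close> are chosen there and its match must be chosen too. Hence either the other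
  part is chosen completely, or at least half of it is, i.e. at least \<open>n / 2 \<ge> k + 1\<close> vertices.
\<close>

definition side :: "nat \<Rightarrow> bool \<Rightarrow> nat set" where
  "side n P = {v \<in> {1..2 * n}. even v = P}"

definition mate :: "nat \<Rightarrow> nat \<Rightarrow> nat" where
  "mate n v = (if v \<le> n then v + n else v - n)"

lemma finite_side [simp]: "finite (side n P)"
  by (simp add: side_def)

lemma side_disjoint: "side n P \<inter> side n (\<not> P) = {}"
  by (auto simp: side_def)

lemma side_Un: "side n P \<union> side n (\<not> P) = {1..2 * n}"
  by (auto simp: side_def)

lemma card_side: "card (side n P) = n"
proof (cases P)
  case True
  have "side n True = (\<lambda>i. 2 * i) ` {1..n}"
    by (auto simp: side_def elim!: evenE)
  with True show ?thesis
    by (simp add: card_image inj_on_def)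
next
  case False
  have "side n False = (\<lambda>i. 2 * i + 1) ` {0..<n}"
    by (auto simp: side_def elim!: oddE)
  with False show ?thesis
    by (simp add: card_image inj_on_def)
qed

text \<open>Shifting by the even number \<open>n\<close> preserves parity.\<close>

lemma mate_in_side:
  assumes "even n" and "v \<in> side n P"
  shows "mate n v \<in> side n P"
  using assms by (auto simp: side_def mate_def)

lemma inj_on_mate: "inj_on (mate n) (side n P)"
  by (auto simp: inj_on_def side_def mate_def split: if_splits)

lemma neighbors_toeplitz_W:
  assumes "0 < n" and "even n" and v: "v \<in> side n P"
  shows "neighbors (toeplitz_graph (2 * n) (toeplitz_W n)) v = insert (mate n v) (side n (\<not> P))"
    (is "neighbors ?G v = _")
proof (rule set_eqI)
  fix u
  have range: "v \<in> {1..2 * n}" "even v = P"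
    using v by (auto simp: side_def)
  have verts: "pverts ?G = {1..2 * n}"
    and arcs: "\<And>i j. (i, j) \<in> parcs ?G \<Longrightarrow> i \<noteq> j"
    by (auto simp: toeplitz_graph_def)
  have parity: "odd \<bar>int v - int u\<bar> \<longleftrightarrow> even u \<noteq> P"
    using range by auto
  show "u \<in> neighbors ?G v \<longleftrightarrow> u \<in> insert (mate n v) (side n (\<not> P))"
  proof (cases "u \<in> {1..2 * n} \<and> u \<noteq> v")
    case True
    then have "u \<in> neighbors ?G v \<longleftrightarrow> even u \<noteq> P \<or> \<bar>int v - int u\<bar> = int n"
      using range toeplitz_graph_W_adjacent_iff[of v n u] parity
      by (simp add: neighbors_def verts)
    also have "\<bar>int v - int u\<bar> = int n \<longleftrightarrow> u = mate n v"
      using range True by (auto simp: mate_def)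
    also have "even u \<noteq> P \<or> u = mate n v \<longleftrightarrow> u \<in> insert (mate n v) (side n (\<not> P))"
      using True by (auto simp: side_def)
    finally show ?thesis .
  \<comment> \<open>Left over are \<open>u = v\<close> and \<open>u\<close> out of range. The left
    side fails for lack of loops or by the vertex set. On the right, the mate is in range and, as
    \<open>n\<close> is positive, differs from \<open>v\<close>.\<close>
  next
    case False
    moreover have "mate n v \<in> {1..2 * n}" "mate n v \<noteq> v"
      using range \<open>0 < n\<close> by (auto simp: mate_def)
    ultimately show ?thesis
      using range arcs by (auto simp: neighbors_def verts side_def)
  qed
qed

text \<open>Each vertex outside \<open>D\<close> sees the whole opposite part, which already holds
  \<open>k\<close> elements of \<open>D\<close>.\<close>

lemma k_dominating_set_if_side_cards:
  assumes "0 < n" and "even n" and "D \<subseteq> {1..2 * n}"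
    and cards: "\<And>P. k \<le> card (D \<inter> side n P)"
  shows "k_dominating_set (toeplitz_graph (2 * n) (toeplitz_W n)) k D"
    (is "k_dominating_set ?G k D")
  unfolding k_dominating_set_def
proof (intro conjI ballI)
  show "D \<subseteq> pverts ?G"
    using assms by (simp add: toeplitz_graph_def)
  fix v assume "v \<in> pverts ?G - D"
  then have v: "v \<in> side n (even v)"
    by (auto simp: toeplitz_graph_def side_def)
  have "k \<le> card (D \<inter> side n (\<not> even v))"
    by (rule cards)
  also have "\<dots> \<le> card (neighbors ?G v \<inter> D)"
    by (rule card_mono) (auto simp: neighbors_toeplitz_W[OF assms(1,2) v])
  finally show "k \<le> card (neighbors ?G v \<inter> D)" .
qed

text \<open>Lower bound when one part is deficient; \<open>P\<close> is arbitrary, so the deficient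
  part may be either one.\<close>

lemma card_k_dominating_set_ge:
  assumes "even n" and "1 \<le> k" and k: "k + 1 \<le> n div 2"
    and D: "k_dominating_set (toeplitz_graph (2 * n) (toeplitz_W n)) k D"
    and small: "card (D \<inter> side n (\<not> P)) < k"
  shows "2 * k \<le> card D"
proof -
  let ?G = "toeplitz_graph (2 * n) (toeplitz_W n)"
  define A where "A = D \<inter> side n (\<not> P)"
  define B where "B = D \<inter> side n P"
  have D_sub: "D \<subseteq> {1..2 * n}"
    using D by (simp add: k_dominating_set_def toeplitz_graph_def)
  have fin: "finite A" "finite B"
    by (simp_all add: A_def B_def)
  have "D = A \<union> B"
    using D_sub side_Un[of n P] by (auto simp: A_def B_def)
  moreover have "A \<inter> B = {}"
    using side_disjoint[of n P] by (auto simp: A_def B_def)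
  ultimately have card_D: "card D = card A + card B"
    using fin by (simp add: card_Un_disjoint)
  \<comment> \<open>The only candidates for neighbours of \<open>v\<close> in \<open>D\<close> are
    the elements of \<open>A\<close> and the mate of \<open>v\<close>. Since \<open>A\<close> falls
    short of \<open>k\<close>, the mate has to supply the last one.\<close>
  have missing: "mate n v \<in> B \<and> k \<le> card A + 1" if v: "v \<in> side n P - B" for v
  proof -
    have "v \<in> pverts ?G - D"
      using v by (auto simp: B_def side_def toeplitz_graph_def)
    then have le: "k \<le> card (neighbors ?G v \<inter> D)"
      using D by (simp add: k_dominating_set_def)
    have nb: "neighbors ?G v = insert (mate n v) (side n (\<not> P))"
      using v k \<open>even n\<close> by (intro neighbors_toeplitz_W) auto
    have "mate n v \<in> D"
    proof (rule ccontr)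
      assume "mate n v \<notin> D"
      then have "neighbors ?G v \<inter> D = A"
        by (auto simp: nb A_def)
      with le small show False
        by (simp add: A_def)
    qed
    moreover from this have "neighbors ?G v \<inter> D = insert (mate n v) A"
      by (auto simp: nb A_def)
    then have "k \<le> card A + 1"
      using le card_insert_le_m1[of "card A + 1" A "mate n v"] by simp
    ultimately show ?thesis
      using v mate_in_side[OF \<open>even n\<close>, of v P] by (auto simp: B_def)
  qed
  have card_missing: "card (side n P - B) = n - card B"
    by (simp add: card_Diff_subset fin B_def card_side)
  show ?thesis
  proof (cases "side n P \<subseteq> B")
    case True
    \<comment> \<open>The full part suffices alone, since n \<ge> 2(k + 1).\<close>
    then have "n \<le> card B"
      using card_mono[OF fin(2) True] by (simp add: card_side)
    with card_D k show ?thesis by linarith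
  next
    case False
    then have "k \<le> card A + 1"
      using missing by blast
    \<comment> \<open>\<open>mate\<close> injects the missing vertices into \<open>B\<close>, so
      \<open>B\<close> is at least half of the part and has at least k + 1 elements. This surplus of
      one offsets the possible deficit of one in \<open>A\<close>.\<close>
    moreover have "card (side n P - B) \<le> card B"
      using missing fin
      by (intro card_inj_on_le[of "mate n"] inj_on_subset[OF inj_on_mate, of _ n P]) auto
    ultimately show ?thesis
      using card_D card_missing k by linarith
  qed
qed

theorem theorem3p15:
  fixes n k :: nat
  assumes "4 \<le> n" and "even n"
    and "1 < k" and "k \<le> n div 2 - 1"
  shows "k_domination_number (toeplitz_graph (2 * n) (toeplitz_W n)) k = 2 * k"
proof -
  let ?G = "toeplitz_graph (2 * n) (toeplitz_W n)"
  \<comment> \<open>The truncated subtraction in the bound on \<open>k\<close> is harmless because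
    \<open>k\<close> is positive. The second fact lets \<open>k\<close> vertices be picked from a
    part of size \<open>n\<close>.\<close>
  have k: "k + 1 \<le> n div 2" "k \<le> n"
    using assms by linarith+
  show ?thesis
    unfolding k_domination_number_def
  proof (rule Min_eqI)
    show "finite {card D | D. k_dominating_set ?G k D}"
      by (rule finite_card_k_dominating_sets) (simp add: toeplitz_graph_def)
  next
    fix c assume "c \<in> {card D | D. k_dominating_set ?G k D}"
    then obtain D where D: "k_dominating_set ?G k D" and c: "c = card D"
      by blast
    show "2 * k \<le> c"
    \<comment> \<open>As \<open>P\<close> runs over both truth values, so does its negation: the
      negative case says that both parts hold at least \<open>k\<close> elements of
      \<open>D\<close>.\<close>
    proof (cases "\<exists>P. card (D \<inter> side n (\<not> P)) < k")
      case True
      then show ?thesis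
        using card_k_dominating_set_ge[OF \<open>even n\<close> _ k(1) D] assms(3) c by auto
    next
      case False
      then have "k \<le> card (D \<inter> side n True)" "k \<le> card (D \<inter> side n False)"
        by (metis not_less)+
      moreover have "card (D \<inter> side n True) + card (D \<inter> side n False)
          = card (D \<inter> side n True \<union> D \<inter> side n False)"
        using side_disjoint[of n True] by (subst card_Un_disjoint) auto
      moreover have "\<dots> \<le> card D"
        using D by (intro card_mono)
          (auto simp: k_dominating_set_def toeplitz_graph_def intro: finite_subset)
      ultimately show ?thesis
        using c by linarith
    qed
  next
    \<comment> \<open>The bound is attained by any \<open>k\<close> even indices together with any
      \<open>k\<close> odd ones.\<close>
    obtain X where X: "X \<subseteq> side n True" "card X = k"
      using obtain_subset_with_card_n[of k "side n True"] k by (auto simp: card_side)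
    obtain Y where Y: "Y \<subseteq> side n False" "card Y = k"
      using obtain_subset_with_card_n[of k "side n False"] k by (auto simp: card_side)
    have disj: "side n True \<inter> side n False = {}"
      using side_disjoint[of n True] by simp
    have fin: "finite X" "finite Y"
      using X Y finite_subset finite_side by blast+
    have "(X \<union> Y) \<inter> side n True = X" "(X \<union> Y) \<inter> side n False = Y"
      using X Y disj by auto
    then have "k \<le> card ((X \<union> Y) \<inter> side n P)" for P
      using X Y by (cases P) simp_all
    moreover have "X \<union> Y \<subseteq> {1..2 * n}"
      using X Y side_Un[of n True] by auto
    ultimately have "k_dominating_set ?G k (X \<union> Y)"
      using assms by (intro k_dominating_set_if_side_cards) auto
    moreover have "card (X \<union> Y) = 2 * k"
      using X Y fin disj by (subst card_Un_disjoint) auto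
    ultimately show "2 * k \<in> {card D | D. k_dominating_set ?G k D}"
      by (auto intro!: exI[of _ "X \<union> Y"])
  qed
qed

end
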